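(* Let $X$ be a metric space with metric $d$, let $T:X\to X$ be a measurable map, and let $\mu$ be a nonatomic invariant Borel probability measure of $T$ with positive expansion exponent, i.e. $E_\mu(T)>0$. Then $\mu$ is positively expansive for $T$.
   Context: A map $T:X\to X$ of a metric space is measurable if the preimage under $T$ of every Borel set is a Borel set. A Borel probability measure of $X$ is a $\sigma$-additive measure $\mu$ on the Borel $\sigma$-algebra of $X$ with $\mu(X)=1$. It is nonatomic if $\mu(\{x\})=0$ for all $x\in X$, and invariant (for $T$) if $\mu(T^{-1}(B))=\mu(B)$ for all Borel sets $B\subset X$. $B(x,\epsilon)$ denotes the open ball of radius $\epsilon$ centered at $x$. For a Borel probability measure $\mu$, the expansion exponent of $\mu$ with respect to $T$ is $$E_\mu(T)=\sup\{\lambda\in\mathbb{R}\mid \exists\,\epsilon>0 \text{ such that } \mu(\{y\in B(x,\epsilon)\mid d(T(x),T(y))<e^\lambda d(x,y)\})=0 \text{ for all } x\in X\},$$ with the convention $\sup\emptyset=-\infty$ (the value lies in $[-\infty,+\infty]$). A Borel probability measure $\mu$ is positively expansive for $T$ if there is $\epsilon>0$ such that $\mu(\Phi_\epsilon(x))=0$ for all $x\in X$, where $$\Phi_\epsilon(x)=\{y\in X: d(T^i(x),T^i(y))\leq\epsilon \text{ for all integers } i\geq 0\}.$$ *)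

theory Defs
  imports "HOL-Probability.Probability_Measure"
begin

definition borel_prob_measure :: "'a::metric_space measure \<Rightarrow> bool" where
  "borel_prob_measure M \<longleftrightarrow> prob_space M \<and> sets M = sets borel"

definition nonatomic :: "'a::metric_space measure \<Rightarrow> bool" where
  "nonatomic M \<longleftrightarrow> (\<forall>x. emeasure M {x} = 0)"

definition invariant_for :: "'a::metric_space measure \<Rightarrow> ('a \<Rightarrow> 'a) \<Rightarrow> bool" where
  "invariant_for M T \<longleftrightarrow> (\<forall>B \<in> sets borel. emeasure M (T -` B) = emeasure M B)"

text \<open>
  The library gives measure 0 to every set outside the sigma-algebra. This is harmless below:
  if \<open>T\<close> is Borel measurable, both kinds of sets being measured are Borel. The point \<open>x\<close>
  is fixed, so \<open>y \<mapsto> dist (T x) (T y)\<close> and \<open>y \<mapsto> dist x y\<close> are real-valued Borel functions,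
  without any separability assumption.

  The supremum is taken in the extended reals, where the empty set has supremum \<open>-\<infinity>\<close>.
\<close>

definition expansion_exponent :: "'a::metric_space measure \<Rightarrow> ('a \<Rightarrow> 'a) \<Rightarrow> ereal" where
  "expansion_exponent M T =
     Sup {ereal l | l :: real. \<exists>\<epsilon>>0. \<forall>x.
            emeasure M {y \<in> ball x \<epsilon>. dist (T x) (T y) < exp l * dist x y} = 0}"

definition dyn_ball :: "('a::metric_space \<Rightarrow> 'a) \<Rightarrow> real \<Rightarrow> 'a \<Rightarrow> 'a set" where
  "dyn_ball T \<epsilon> x = {y. \<forall>i::nat. dist ((T ^^ i) x) ((T ^^ i) y) \<le> \<epsilon>}"

definition positively_expansive :: "'a::metric_space measure \<Rightarrow> ('a \<Rightarrow> 'a) \<Rightarrow> bool" where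
  "positively_expansive M T \<longleftrightarrow> (\<exists>\<epsilon>>0. \<forall>x. emeasure M (dyn_ball T \<epsilon> x) = 0)"

end

theory Submission
  imports Defs
begin

text \<open>
  Positivity of the exponent yields \<open>l > 0\<close> and \<open>\<epsilon> > 0\<close> such that, seen from any point, almost every
  point closer than \<open>\<epsilon>\<close> moves away by a factor of at least \<open>exp l > 1\<close> under one step of \<open>T\<close>.
  Fix \<open>x\<close>. A point \<open>y\<close> whose orbit stays within \<open>\<epsilon>/2\<close> of the orbit of \<open>x\<close> can be expanded at
  every time only if \<open>y = x\<close>, since otherwise the distance of the two orbits would grow
  geometrically. So each other point of the dynamical ball fails to be expanded at some time \<open>i\<close>,
  that is, it lies in the preimage under \<open>T ^^ i\<close> of the exceptional set of \<open>(T ^^ i) x\<close>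
  (\<open>dyn_ball_subset\<close>). By invariance (\<open>invariant_for_funpow\<close>) each of these countably many preimages
  is null, and nonatomicity takes care of \<open>x\<close> itself.
\<close>

definition non_expanded :: "('a::metric_space \<Rightarrow> 'a) \<Rightarrow> real \<Rightarrow> real \<Rightarrow> 'a \<Rightarrow> 'a set" where
  "non_expanded T l \<epsilon> x = {y \<in> ball x \<epsilon>. dist (T x) (T y) < exp l * dist x y}"

lemma expansion_exponent_posE:
  assumes "expansion_exponent M T > 0"
  obtains l \<epsilon> where "l > 0" "\<epsilon> > 0" "\<And>x. emeasure M (non_expanded T l \<epsilon> x) = 0"
proof -
  obtain l \<epsilon> where "ereal l > 0" "\<epsilon> > 0" "\<forall>x. emeasure M (non_expanded T l \<epsilon> x) = 0"
    using assms unfolding expansion_exponent_def less_Sup_iff non_expanded_def by blast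
  then show thesis
    using that[of l \<epsilon>] by simp
qed

text \<open>
  On a non-separable space \<open>dist\<close> need not be measurable for the product of the Borel algebras.
  Here both distances are taken from a fixed point, and such a distance is a continuous function of
  the other point alone.
\<close>
lemma non_expanded_borel:
  fixes T :: "'a::metric_space \<Rightarrow> 'a"
  assumes T: "T \<in> borel \<rightarrow>\<^sub>M borel"
  shows "non_expanded T l \<epsilon> x \<in> sets borel"
proof -
  have dist_meas: "(\<lambda>y::'a. dist a y) \<in> borel \<rightarrow>\<^sub>M borel" for a
    by (intro borel_measurable_continuous_onI continuous_intros)
  have image_meas: "(\<lambda>y. dist (T x) (T y)) \<in> borel \<rightarrow>\<^sub>M borel"
    using measurable_compose[OF T dist_meas] .
  have "{y \<in> space borel. dist (T x) (T y) < exp l * dist x y} \<in> sets borel"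
    by (intro borel_measurable_less image_meas borel_measurable_times dist_meas
        borel_measurable_const)
  then have "ball x \<epsilon> \<inter> {y. dist (T x) (T y) < exp l * dist x y} \<in> sets borel"
    by (intro sets.Int) auto
  then show ?thesis
    unfolding non_expanded_def by (simp add: Int_def)
qed

lemma invariant_for_funpow:
  assumes T: "T \<in> borel \<rightarrow>\<^sub>M borel" and inv: "invariant_for M T"
  shows "invariant_for M (T ^^ i)"
proof (induction i)
  case 0
  then show ?case by (simp add: invariant_for_def)
next
  case (Suc i)
  have "emeasure M ((T ^^ Suc i) -` B) = emeasure M B" if B: "B \<in> sets borel" for B
  proof -
    have "T -` B \<in> sets borel"
      using measurable_sets[OF T B] by simp
    then have "emeasure M ((T ^^ i) -` (T -` B)) = emeasure M B"
      using Suc inv B by (simp add: invariant_for_def)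
    then show ?thesis
      by (simp add: vimage_def)
  qed
  then show ?case
    unfolding invariant_for_def by blast
qed

lemma geometric_growth:
  fixes a :: "nat \<Rightarrow> real"
  assumes "c \<ge> 0" "\<And>i. a (Suc i) \<ge> c * a i"
  shows "c ^ n * a 0 \<le> a n"
proof (induction n)
  case (Suc n)
  have "c ^ Suc n * a 0 \<le> c * a n"
    using mult_left_mono[OF Suc \<open>c \<ge> 0\<close>] by (simp add: mult.assoc)
  also have "\<dots> \<le> a (Suc n)"
    by (rule assms)
  finally show ?case .
qed simp

text \<open>
  The dynamical ball is defined by a non-strict inequality and the exceptional sets lie in open
  balls, so the radius \<open>\<delta>\<close> has to be strictly smaller than \<open>\<epsilon>\<close>.
\<close>
lemma dyn_ball_subset:
  assumes "l > 0" "\<delta> < \<epsilon>"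
  shows "dyn_ball T \<delta> x \<subseteq> insert x (\<Union>i. (T ^^ i) -` non_expanded T l \<epsilon> ((T ^^ i) x))"
proof
  fix y assume y: "y \<in> dyn_ball T \<delta> x"
  define a where "a i = dist ((T ^^ i) x) ((T ^^ i) y)" for i
  have a_le: "a i \<le> \<delta>" for i
    using y by (simp add: dyn_ball_def a_def)
  show "y \<in> insert x (\<Union>i. (T ^^ i) -` non_expanded T l \<epsilon> ((T ^^ i) x))"
  proof (rule ccontr)
    assume contra: "y \<notin> insert x (\<Union>i. (T ^^ i) -` non_expanded T l \<epsilon> ((T ^^ i) x))"
    have "a (Suc i) \<ge> exp l * a i" for i
    proof -
      have "(T ^^ i) y \<notin> non_expanded T l \<epsilon> ((T ^^ i) x)"
        using contra by blast
      then show ?thesis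
        using a_le[of i] \<open>\<delta> < \<epsilon>\<close> by (simp add: non_expanded_def a_def)
    qed
    then have growth: "exp l ^ n * a 0 \<le> \<delta>" for n
      using geometric_growth[of "exp l" a n] a_le[of n] by simp
    have a0: "a 0 > 0"
      using contra by (auto simp: a_def)
    obtain n where "\<delta> / a 0 < exp l ^ n"
      using real_arch_pow[of "exp l" "\<delta> / a 0"] \<open>l > 0\<close> by auto
    with growth[of n] a0 show False
      by (simp add: field_simps)
  qed
qed

theorem theoremB:
  fixes T :: "'a::metric_space \<Rightarrow> 'a" and M :: "'a measure"
  assumes "T \<in> borel \<rightarrow>\<^sub>M borel"
    and "borel_prob_measure M"
    and "nonatomic M"
    and "invariant_for M T"
    and "expansion_exponent M T > 0"
  shows "positively_expansive M T"
proof -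
  obtain l \<epsilon> where l: "l > 0" and \<epsilon>: "\<epsilon> > 0"
    and null: "\<And>x. emeasure M (non_expanded T l \<epsilon> x) = 0"
    using expansion_exponent_posE[OF assms(5)] by blast
  have sets_M: "sets M = sets borel"
    using assms(2) by (simp add: borel_prob_measure_def)
  have "emeasure M (dyn_ball T (\<epsilon> / 2) x) = 0" for x
  proof -
    define N where "N i = (T ^^ i) -` non_expanded T l \<epsilon> ((T ^^ i) x)" for i
    have "N i \<in> null_sets M" for i
    proof -
      have "T ^^ i \<in> borel \<rightarrow>\<^sub>M borel"
        using assms(1) by (induction i) (auto intro: measurable_comp)
      then have "N i \<in> sets M"
        using measurable_sets[OF _ non_expanded_borel[OF assms(1)], of "T ^^ i" borel]
        by (simp add: N_def sets_M)
      moreover have "emeasure M (N i) = 0"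
        using invariant_for_funpow[OF assms(1,4), of i] non_expanded_borel[OF assms(1)] null
        by (simp add: invariant_for_def N_def)
      ultimately show ?thesis
        by (simp add: null_setsI)
    qed
    then have "(\<Union>i. N i) \<in> null_sets M"
      by blast
    moreover have "{x} \<in> null_sets M"
      using assms(3) by (simp add: nonatomic_def null_sets_def sets_M)
    ultimately have "insert x (\<Union>i. N i) \<in> null_sets M"
      using null_sets.Un[of "{x}" M "\<Union>i. N i"] by simp
    moreover have "dyn_ball T (\<epsilon> / 2) x \<subseteq> insert x (\<Union>i. N i)"
      unfolding N_def using dyn_ball_subset[of l "\<epsilon> / 2" \<epsilon> T x] l \<epsilon> by simp
    ultimately show ?thesis
      using emeasure_mono[of "dyn_ball T (\<epsilon> / 2) x" "insert x (\<Union>i. N i)" M]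
      by (simp add: null_sets_def)
  qed
  then show ?thesis
    unfolding positively_expansive_def using \<epsilon> by (intro exI[of _ "\<epsilon> / 2"]) simp
qed

end
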